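(* Consider the nonlinear system $\dot x(t)=f(x(t))+Bw(t)$, $z(t)=Cx(t)$ with $CB=0$ under the standing assumptions in the context, with disturbances generated by the exosystem described in the context (with constant $\beta$). Suppose the system is $(Q,S,R)$-velocity dissipative with $(Q,S,R)=(\gamma^2I,0,-I)$, and let $\alpha>0$ be a constant such that, with $R=-I$, for all $x_*\in\mathscr X$ and $x\in\mathcal X$ $$(x-x_* )^\top\bar A(x,x_* )^\top C^\top RC\bar A(x,x_* )(x-x_* )\le\alpha^{-1}(x-x_* )^\top C^\top RC(x-x_* ),$$ where $\bar A(x,x_* )=\int_0^1\frac{\partial f}{\partial x}(x_*+\lambda(x-x_* ))\,d\lambda$. Then the system has a universal shifted $\mathcal L_2$-gain ($\mathcal L_{\mathrm s2}$-gain) bound of $\tilde\gamma=\sqrt{\alpha\beta^2\gamma^2}$.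
   Context: System: $\dot x=f(x)+Bw$, $z=Cx$ on $t\in[0,\infty)$, with $x(t)\in\mathcal X\subseteq\mathbb R^{n_x}$, $w(t)\in\mathcal W\subseteq\mathbb R^{n_w}$, $z(t)\in\mathcal Z\subseteq\mathbb R^{n_z}$, $f:\mathcal X\to\mathbb R^{n_x}$ in $\mathcal C_1$ ($\mathcal C_n$ = $n$-times continuously differentiable), $B,C$ constant real matrices. The state set $\mathcal X$ is convex and compact. $\mathfrak B$ is the set of all $(x,w,z):[0,\infty)\to\mathcal X\times\mathcal W\times\mathcal Z$ with $x\in\mathcal C_1$ satisfying these equations; solutions are assumed forward complete and unique. Equilibria: $\mathscr E=\{(x_*,w_*,z_* )\in\mathcal X\times\mathcal W\times\mathcal Z: 0=f(x_* )+Bw_*,\ z_*=Cx_*\}$, with projections $\mathscr X,\mathscr W,\mathscr Z$. Standing assumption: there is a bijection $\kappa:\mathscr W\to\mathscr X$ with $x_*=\kappa(w_* )$ for all equilibrium pairs $(x_*,w_* )$. $\mathfrak B^{\mathrm C}=\{(x,w,z)\in\mathfrak B: x\in\mathcal C_2,\ w,z\in\mathcal C_1\}$ (differentiability also at $t=0$), and $\mathfrak B^{\mathrm{VF}}=\{(\dot x,\dot w,\dot z):(x,w,z)\in\mathfrak B^{\mathrm C}\}$. $(Q,S,R)$-velocity dissipativity ($Q=Q^\top$, $R=R^\top$): there is $\mathcal V_{\mathrm v}:\mathbb R^{n_x}\to[0,\infty)$, $\mathcal V_{\mathrm v}\in\mathcal C_1$, positive definite and decrescent with respect to $0$ (i.e.,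 $a(\|\xi\|)\le\mathcal V_{\mathrm v}(\xi)\le b(\|\xi\|)$ for some continuous strictly increasing $a,b:[0,\infty)\to[0,\infty)$ vanishing at $0$), such that for all $0\le t_0\le t_1$ and $(\dot x,\dot w,\dot z)\in\mathfrak B^{\mathrm{VF}}$, $$\mathcal V_{\mathrm v}(\dot x(t_1))-\mathcal V_{\mathrm v}(\dot x(t_0))\le\int_{t_0}^{t_1}\begin{bmatrix}\dot w\\\dot z\end{bmatrix}^\top\begin{bmatrix}Q&S\\S^\top&R\end{bmatrix}\begin{bmatrix}\dot w\\\dot z\end{bmatrix}dt.$$ Exosystem assumption: for a given equilibrium $(x_*,w_*,z_* )\in\mathscr E$, $w$ is generated by $\dot w(t)=A_{\mathrm w}(w(t)-w_* )$, where $A_{\mathrm w}\in\mathbb R^{n_w\times n_w}$ is Hurwitz and its induced 2-norm satisfies $\|A_{\mathrm w}\|_{2,2}\le\beta$; $\mathfrak W_{w_*}$ denotes the set of $w:[0,\infty)\to\mathcal W$ with $\dot w\in\mathcal C_1$ that satisfy this equation. $\mathcal L_{\mathrm s2}$-gain bound $\tilde\gamma$ (under the exosystem assumption): there is a function $\zeta_{\mathrm s}:\mathcal X\times\mathscr X\to\mathbb R$ such that for every $(x_*,w_*,z_* )\in\mathscr E$, $\|z-z_*\|_{2,T}\le\tilde\gamma\|w-w_*\|_{2,T}+\zeta_{\mathrm s}(x(0),x_* )$ for all $T\ge0$ and all $(x,w,z)\in\mathfrak B$ with $w\in\mathcal L_{2\mathrm e}$ and $w\in\mathfrak W_{w_*}$,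 where $\|g\|_{2,T}=(\int_0^T\|g(t)\|^2dt)^{1/2}$ and $\mathcal L_{2\mathrm e}$ is the space of functions with $\|g\|_{2,T}<\infty$ for all $T\geq 0$. *)

theory Defs
  imports "HOL-Analysis.Analysis"
begin

section \<open>Differentiability\<close>

text \<open>
  Derivatives are taken within the time interval \<open>J\<close>, hence one-sided at its end points;
  for \<open>J = {0..}\<close> they are defined at \<open>t = 0\<close> as well.
\<close>

definition time_deriv :: "real set \<Rightarrow> (real \<Rightarrow> 'a::real_normed_vector) \<Rightarrow> real \<Rightarrow> 'a" where
  "time_deriv J g = (\<lambda>t. vector_derivative g (at t within J))"

primrec cont_diff :: "nat \<Rightarrow> real set \<Rightarrow> (real \<Rightarrow> 'a::real_normed_vector) \<Rightarrow> bool" where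
  "cont_diff 0 J g \<longleftrightarrow> continuous_on J g"
| "cont_diff (Suc n) J g \<longleftrightarrow> g differentiable_on J \<and> cont_diff n J (time_deriv J g)"

text \<open>
  The Jacobian \<open>Df\<close> is carried explicitly, because the derivative of \<open>f\<close> within \<open>X\<close> is not
  unique when \<open>X\<close> has empty interior.
\<close>

definition C1_with_jacobian ::
    "(real^'n) set \<Rightarrow> (real^'n \<Rightarrow> real^'m) \<Rightarrow> (real^'n \<Rightarrow> real^'n^'m) \<Rightarrow> bool" where
  "C1_with_jacobian X f Df \<longleftrightarrow>
     (\<forall>x\<in>X. (f has_derivative (\<lambda>h. Df x *v h)) (at x within X)) \<and> continuous_on X Df"

definition C1_scalar :: "(real^'n \<Rightarrow> real) \<Rightarrow> bool" where
  "C1_scalar V \<longleftrightarrow>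
     (\<exists>grad. (\<forall>\<xi>. (V has_derivative (\<lambda>h. grad \<xi> \<bullet> h)) (at \<xi>)) \<and> continuous_on UNIV grad)"

section \<open>The system and its behaviour\<close>

type_synonym ('nx, 'nw, 'nz) traj =
  "(real \<Rightarrow> real^'nx) \<times> (real \<Rightarrow> real^'nw) \<times> (real \<Rightarrow> real^'nz)"

text \<open>
  Trajectories are total functions on \<open>real\<close>, of which only the restriction to the time
  interval \<open>J\<close> is constrained and used.
\<close>

definition solution_on ::
    "real set \<Rightarrow> (real^'nx) set \<Rightarrow> (real^'nw) set \<Rightarrow> (real^'nz) set \<Rightarrow>
     (real^'nx \<Rightarrow> real^'nx) \<Rightarrow> real^'nw^'nx \<Rightarrow> real^'nx^'nz \<Rightarrow>
     (real \<Rightarrow> real^'nx) \<Rightarrow> (real \<Rightarrow> real^'nw) \<Rightarrow> (real \<Rightarrow> real^'nz) \<Rightarrow> bool" where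
  "solution_on J X W Z f B C x w z \<longleftrightarrow>
     cont_diff 1 J x \<and>
     (\<forall>t\<in>J. x t \<in> X \<and> w t \<in> W \<and> z t \<in> Z \<and>
        (x has_vector_derivative (f (x t) + B *v w t)) (at t within J) \<and>
        z t = C *v x t)"

definition behaviour ::
    "(real^'nx) set \<Rightarrow> (real^'nw) set \<Rightarrow> (real^'nz) set \<Rightarrow>
     (real^'nx \<Rightarrow> real^'nx) \<Rightarrow> real^'nw^'nx \<Rightarrow> real^'nx^'nz \<Rightarrow> ('nx, 'nw, 'nz) traj set" where
  "behaviour X W Z f B C = {(x, w, z). solution_on {0..} X W Z f B C x w z}"

definition forward_complete ::
    "(real^'nx) set \<Rightarrow> (real^'nw) set \<Rightarrow> (real^'nz) set \<Rightarrow>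
     (real^'nx \<Rightarrow> real^'nx) \<Rightarrow> real^'nw^'nx \<Rightarrow> real^'nx^'nz \<Rightarrow> bool" where
  "forward_complete X W Z f B C \<longleftrightarrow>
     (\<forall>\<tau>>0. \<forall>x w z.
        continuous_on {0..} w \<and> (\<forall>t\<ge>0. w t \<in> W) \<and> solution_on {0..\<tau>} X W Z f B C x w z \<longrightarrow>
        (\<exists>x' z'. (x', w, z') \<in> behaviour X W Z f B C \<and> (\<forall>t\<in>{0..\<tau>}. x' t = x t)))"

definition unique_solutions ::
    "(real^'nx) set \<Rightarrow> (real^'nw) set \<Rightarrow> (real^'nz) set \<Rightarrow>
     (real^'nx \<Rightarrow> real^'nx) \<Rightarrow> real^'nw^'nx \<Rightarrow> real^'nx^'nz \<Rightarrow> bool" where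
  "unique_solutions X W Z f B C \<longleftrightarrow>
     (\<forall>(x, w, z) \<in> behaviour X W Z f B C. \<forall>(x', w', z') \<in> behaviour X W Z f B C.
        x 0 = x' 0 \<and> (\<forall>t\<ge>0. w t = w' t) \<longrightarrow> (\<forall>t\<ge>0. x t = x' t))"

section \<open>Equilibria\<close>

definition equilibria ::
    "(real^'nx) set \<Rightarrow> (real^'nw) set \<Rightarrow> (real^'nz) set \<Rightarrow>
     (real^'nx \<Rightarrow> real^'nx) \<Rightarrow> real^'nw^'nx \<Rightarrow> real^'nx^'nz \<Rightarrow>
     ((real^'nx) \<times> (real^'nw) \<times> (real^'nz)) set" where
  "equilibria X W Z f B C =
     {(xs, ws, zs). xs \<in> X \<and> ws \<in> W \<and> zs \<in> Z \<and> 0 = f xs + B *v ws \<and> zs = C *v xs}"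

definition eq_states :: "('a \<times> 'b \<times> 'c) set \<Rightarrow> 'a set" where
  "eq_states E = fst ` E"

definition eq_inputs :: "('a \<times> 'b \<times> 'c) set \<Rightarrow> 'b set" where
  "eq_inputs E = (fst \<circ> snd) ` E"

definition equilibrium_bijection :: "('a \<times> 'b \<times> 'c) set \<Rightarrow> bool" where
  "equilibrium_bijection E \<longleftrightarrow>
     (\<exists>\<kappa>. bij_betw \<kappa> (eq_inputs E) (eq_states E) \<and> (\<forall>(xs, ws, zs) \<in> E. xs = \<kappa> ws))"

section \<open>Velocity dissipativity\<close>

definition behaviour_C ::
    "(real^'nx) set \<Rightarrow> (real^'nw) set \<Rightarrow> (real^'nz) set \<Rightarrow>
     (real^'nx \<Rightarrow> real^'nx) \<Rightarrow> real^'nw^'nx \<Rightarrow> real^'nx^'nz \<Rightarrow> ('nx, 'nw, 'nz) traj set" where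
  "behaviour_C X W Z f B C =
     {(x, w, z) \<in> behaviour X W Z f B C.
        cont_diff 2 {0..} x \<and> cont_diff 1 {0..} w \<and> cont_diff 1 {0..} z}"

definition behaviour_VF ::
    "(real^'nx) set \<Rightarrow> (real^'nw) set \<Rightarrow> (real^'nz) set \<Rightarrow>
     (real^'nx \<Rightarrow> real^'nx) \<Rightarrow> real^'nw^'nx \<Rightarrow> real^'nx^'nz \<Rightarrow> ('nx, 'nw, 'nz) traj set" where
  "behaviour_VF X W Z f B C =
     (\<lambda>(x, w, z). (time_deriv {0..} x, time_deriv {0..} w, time_deriv {0..} z)) `
       behaviour_C X W Z f B C"

text \<open>The quadratic form of the symmetric block matrix with blocks \<open>Q\<close>, \<open>S\<close>, \<open>S\<close> transposed, \<open>R\<close>.\<close>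

definition supply_rate ::
    "real^'nw^'nw \<Rightarrow> real^'nz^'nw \<Rightarrow> real^'nz^'nz \<Rightarrow> real^'nw \<Rightarrow> real^'nz \<Rightarrow> real" where
  "supply_rate Q S R w z =
     w \<bullet> (Q *v w) + w \<bullet> (S *v z) + z \<bullet> (transpose S *v w) + z \<bullet> (R *v z)"

definition comparison_fun :: "(real \<Rightarrow> real) \<Rightarrow> bool" where
  "comparison_fun a \<longleftrightarrow>
     continuous_on {0..} a \<and> strict_mono_on {0..} a \<and> a ` {0..} \<subseteq> {0..} \<and> a 0 = 0"

definition pos_def_decrescent :: "(real^'n \<Rightarrow> real) \<Rightarrow> bool" where
  "pos_def_decrescent V \<longleftrightarrow>
     (\<exists>a b. comparison_fun a \<and> comparison_fun b \<and>
        (\<forall>\<xi>. a (norm \<xi>) \<le> V \<xi> \<and> V \<xi> \<le> b (norm \<xi>)))"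

definition velocity_dissipative ::
    "(real^'nx) set \<Rightarrow> (real^'nw) set \<Rightarrow> (real^'nz) set \<Rightarrow>
     (real^'nx \<Rightarrow> real^'nx) \<Rightarrow> real^'nw^'nx \<Rightarrow> real^'nx^'nz \<Rightarrow>
     real^'nw^'nw \<Rightarrow> real^'nz^'nw \<Rightarrow> real^'nz^'nz \<Rightarrow> bool" where
  "velocity_dissipative X W Z f B C Q S R \<longleftrightarrow>
     Q = transpose Q \<and> R = transpose R \<and>
     (\<exists>V :: real^'nx \<Rightarrow> real.
        (\<forall>\<xi>. 0 \<le> V \<xi>) \<and> C1_scalar V \<and> pos_def_decrescent V \<and>
        (\<forall>t0 t1. 0 \<le> t0 \<and> t0 \<le> t1 \<longrightarrow>
           (\<forall>(dx, dw, dz) \<in> behaviour_VF X W Z f B C.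
              V (dx t1) - V (dx t0) \<le> integral {t0..t1} (\<lambda>t. supply_rate Q S R (dw t) (dz t)))))"

section \<open>Exosystem\<close>

definition hurwitz :: "real^'n^'n \<Rightarrow> bool" where
  "hurwitz A \<longleftrightarrow>
     (\<forall>(l::complex) (v::complex^'n).
        v \<noteq> 0 \<and> (\<chi> i j. complex_of_real (A $ i $ j)) *v v = l *s v \<longrightarrow> Re l < 0)"

definition exo_inputs ::
    "(real^'nw) set \<Rightarrow> real^'nw^'nw \<Rightarrow> real^'nw \<Rightarrow> (real \<Rightarrow> real^'nw) set" where
  "exo_inputs W Aw ws =
     {w. cont_diff 1 {0..} (time_deriv {0..} w) \<and>
         (\<forall>t\<ge>0. w t \<in> W \<and> (w has_vector_derivative (Aw *v (w t - ws))) (at t within {0..}))}"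

section \<open>Universal shifted L2-gain\<close>

definition L2_seminorm :: "real \<Rightarrow> (real \<Rightarrow> 'a::euclidean_space) \<Rightarrow> real" where
  "L2_seminorm T g = sqrt (integral {0..T} (\<lambda>t. (norm (g t))\<^sup>2))"

text \<open>
  For the nonnegative integrand \<open>(norm (g t))\<^sup>2\<close> gauge integrability and Lebesgue integrability
  on \<open>{0..T}\<close> coincide.
\<close>

definition L2e :: "(real \<Rightarrow> 'a::euclidean_space) set" where
  "L2e = {g. g \<in> borel_measurable (lebesgue_on {0..}) \<and>
             (\<forall>T\<ge>0. (\<lambda>t. (norm (g t))\<^sup>2) integrable_on {0..T})}"

definition Ls2_gain_bound ::
    "(real^'nx) set \<Rightarrow> (real^'nw) set \<Rightarrow> (real^'nz) set \<Rightarrow>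
     (real^'nx \<Rightarrow> real^'nx) \<Rightarrow> real^'nw^'nx \<Rightarrow> real^'nx^'nz \<Rightarrow> real^'nw^'nw \<Rightarrow> real \<Rightarrow> bool" where
  "Ls2_gain_bound X W Z f B C Aw g \<longleftrightarrow>
     (\<exists>\<zeta> :: real^'nx \<Rightarrow> real^'nx \<Rightarrow> real.
        \<forall>(xs, ws, zs) \<in> equilibria X W Z f B C.
        \<forall>T\<ge>0. \<forall>(x, w, z) \<in> behaviour X W Z f B C.
          w \<in> L2e \<and> w \<in> exo_inputs W Aw ws \<longrightarrow>
          L2_seminorm T (\<lambda>t. z t - zs) \<le> g * L2_seminorm T (\<lambda>t. w t - ws) + \<zeta> (x 0) xs)"

section \<open>Averaged Jacobian\<close>

definition Abar :: "(real^'n \<Rightarrow> real^'n^'n) \<Rightarrow> real^'n \<Rightarrow> real^'n \<Rightarrow> real^'n^'n" where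
  "Abar Df x xs = integral {0..1} (\<lambda>l. Df (xs + l *\<^sub>R (x - xs)))"

end

theory Submission
  imports Defs
begin

text \<open>
  Since \<open>C B = 0\<close>, the output derivative is \<open>C f(x) = C (f(x) - f(x\<^sub>*)) = C A (x - x\<^sub>*)\<close> with \<open>A\<close> the
  averaged Jacobian, so the matrix inequality gives \<open>|z - z\<^sub>*|\<^sup>2 \<le> \<alpha> |z'|\<^sup>2\<close>, while the exosystem gives
  \<open>|w'| \<le> \<beta> |w - w\<^sub>*|\<close>. Velocity dissipativity then yields the gain bound up to the storage of the
  initial velocity \<open>f(x 0) + B w 0\<close>. The offset may depend on \<open>x 0\<close> and \<open>x\<^sub>*\<close> only, and \<open>w 0\<close> may range over
  an unbounded set. But \<open>x\<close> stays in a compact set, which bounds the integral of \<open>B (w - w\<^sub>*)\<close> on the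
  unit interval; as \<open>w - w\<^sub>*\<close> solves a linear ODE, this bounds \<open>B (w 0 - w\<^sub>*)\<close>.
\<close>

section \<open>Taylor series and initial values of linear ODEs\<close>

text \<open>The derivative of the order \<open>Suc n\<close> remainder of \<open>h k\<close> is the
  order \<open>n\<close> remainder of \<open>h (Suc k)\<close>, so each induction step integrates
  the previous bound once. The geometric form \<open>M * L ^ k\<close> lets the majorant reproduce
  itself under this shift of \<open>k\<close>.\<close>

lemma derivative_chain_taylor_bound:
  fixes h :: "nat \<Rightarrow> real \<Rightarrow> real"
  assumes deriv: "\<And>k t. t \<in> {0..1} \<Longrightarrow> (h k has_real_derivative h (Suc k) t) (at t within {0..1})"
    and bound: "\<And>k t. t \<in> {0..1} \<Longrightarrow> \<bar>h k t\<bar> \<le> M * L ^ k"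
    and t: "t \<in> {0..1}"
  shows "\<bar>h k t - (\<Sum>j<n. t ^ j / fact j * h (k + j) 0)\<bar> \<le> M * L ^ (k + n) * t ^ n / fact n"
  using t
proof (induction n arbitrary: k t)
  case 0
  then show ?case using bound[of t k] by simp
next
  case (Suc n)
  define g where "g = (\<lambda>s. h k s - (\<Sum>j<Suc n. s ^ j / fact j * h (k + j) 0))"
  define g' where "g' = (\<lambda>s. h (Suc k) s - (\<Sum>j<n. s ^ j / fact j * h (Suc k + j) 0))"
  define p where "p = (\<lambda>s. M * L ^ (k + Suc n) * s ^ Suc n / fact (Suc n))"
  define p' where "p' = (\<lambda>s. M * L ^ (Suc k + n) * s ^ n / fact n)"
  \<comment> \<open>The term \<open>j = 0\<close> is the constant \<open>h k 0\<close>. After the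
    index shift, differentiating a remaining summand lowers its power by one.\<close>
  have split: "g = (\<lambda>s. h k s - h k 0 - (\<Sum>j<n. s ^ Suc j / fact (Suc j) * h (Suc k + j) 0))"
    unfolding g_def by (subst sum.lessThan_Suc_shift) (simp add: algebra_simps)
  have pw: "((\<lambda>s. s ^ Suc j / fact (Suc j) :: real) has_real_derivative s ^ j / fact j) (at s within S)"
    for j s S
    by (rule derivative_eq_intros refl | simp)+
  have dg: "(g has_real_derivative g' s) (at s within {0..1})" if "s \<in> {0..1}" for s
  proof -
    have "(g has_real_derivative h (Suc k) s - 0 - (\<Sum>j<n. s ^ j / fact j * h (Suc k + j) 0))
        (at s within {0..1})"
      unfolding split
      by (intro DERIV_diff DERIV_sum DERIV_const DERIV_cmult_right pw deriv that)
    then show ?thesis by (simp add: g'_def)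
  qed
  have dp: "(p has_real_derivative p' s) (at s within S)" for s S
  proof -
    have "p = (\<lambda>s. M * L ^ (k + Suc n) * (s ^ Suc n / fact (Suc n)))"
      by (simp add: p_def)
    moreover have "p' s = M * L ^ (k + Suc n) * (s ^ n / fact n)"
      by (simp add: p'_def)
    ultimately show ?thesis
      using DERIV_cmult[OF pw] by metis
  qed
  have g0: "g 0 = 0" "p 0 = 0" by (simp_all add: split p_def)
  show ?case
  \<comment> \<open>The mean value inequality needs a nondegenerate interval; at 0 both remainder
    and majorant vanish.\<close>
  proof (cases "t = 0")
    case True
    with g0 show ?thesis unfolding g_def p_def by simp
  next
    case False
    with Suc.prems have t: "0 < t" "t \<le> 1" by auto
    have "norm (g t - g 0) \<le> p t - p 0"
    proof (rule differentiable_bound_general[OF t(1)])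
      show "continuous_on {0..t} p"
        using dp by (meson DERIV_continuous_on)
      have "continuous_on {0..1} g"
        using dg by (meson DERIV_continuous_on)
      then show "continuous_on {0..t} g"
        by (rule continuous_on_subset) (use t in auto)
    next
      fix s assume s: "0 < s" "s < t"
      show "(p has_vector_derivative p' s) (at s)"
        using dp[of s UNIV] by (simp add: has_real_derivative_iff_has_vector_derivative)
      have "at s within {0..1} = at s"
        by (rule at_within_interior) (use s t in auto)
      then show "(g has_vector_derivative g' s) (at s)"
        using dg[of s] s t by (simp add: has_real_derivative_iff_has_vector_derivative)
      show "norm (g' s) \<le> p' s"
        using Suc.IH[of s "Suc k"] s t by (simp add: g'_def p'_def)
    qed
    then show ?thesis
      using g0 by (simp add: g_def p_def)
  qed
qed

text \<open>The remainder bound is a constant multiple of a term of the exponential series of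
  \<open>L * t\<close>, hence a null sequence.\<close>

lemma derivative_chain_sums:
  fixes h :: "nat \<Rightarrow> real \<Rightarrow> real"
  assumes "\<And>k t. t \<in> {0..1} \<Longrightarrow> (h k has_real_derivative h (Suc k) t) (at t within {0..1})"
    and "\<And>k t. t \<in> {0..1} \<Longrightarrow> \<bar>h k t\<bar> \<le> M * L ^ k"
    and t: "t \<in> {0..1}"
  shows "(\<lambda>j. t ^ j / fact j * h j 0) sums h 0 t"
proof -
  have "(\<lambda>n. M * (L * t) ^ n / fact n) \<longlonglongrightarrow> 0"
    using tendsto_mult_right_zero[OF summable_LIMSEQ_zero[OF summable_exp[of "L * t"]], of M]
    by (simp add: divide_inverse mult_ac)
  then have "(\<lambda>n. (\<Sum>j<n. t ^ j / fact j * h j 0) - h 0 t) \<longlonglongrightarrow> 0"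
  proof (rule Lim_null_comparison[rotated], intro always_eventually allI)
    fix n
    show "norm ((\<Sum>j<n. t ^ j / fact j * h j 0) - h 0 t) \<le> M * (L * t) ^ n / fact n"
      using derivative_chain_taylor_bound[OF assms, of 0 n]
      by (simp add: abs_minus_commute power_mult_distrib mult_ac)
  qed
  then show ?thesis
    unfolding sums_def by (rule LIM_zero_cancel)
qed

text \<open>
  The integral of \<open>b \<bullet> y\<close> over \<open>{0..t}\<close> is \<open>t * (H t \<bullet> y 0)\<close>, where \<open>H\<close> depends only on \<open>A\<close> and \<open>b\<close>
  and \<open>H t\<close> tends to \<open>b\<close> as \<open>t\<close> tends to 0. Spans are closed, so \<open>b\<close> is a finite linear
  combination of the \<open>H t\<close>.
\<close>

lemma linear_ode_initial_bound:
  fixes A :: "'a::euclidean_space \<Rightarrow> 'a" and b :: 'a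
  assumes "linear A"
  shows "\<exists>K. \<forall>y q N.
    (\<forall>t\<in>{0..1}. (y has_vector_derivative A (y t)) (at t within {0..1})) \<longrightarrow>
    (\<forall>t\<in>{0..1}. (q has_real_derivative b \<bullet> y t) (at t within {0..1})) \<longrightarrow>
    (\<forall>t\<in>{0..1}. \<bar>q t - q 0\<bar> \<le> N) \<longrightarrow> \<bar>b \<bullet> y 0\<bar> \<le> K * N"
proof -
  \<comment> \<open>Moving \<open>A\<close> to the other side of the inner product makes
    \<open>c k \<bullet> y\<close> the \<open>k\<close>-th derivative of
    \<open>b \<bullet> y\<close> along solutions.\<close>
  define c where "c = (\<lambda>k. (adjoint A ^^ k) b)"
  have linA': "linear (adjoint A)"
    using assms by (rule adjoint_linear)
  obtain L0 where L0: "\<And>v. norm (adjoint A v) \<le> L0 * norm v" "L0 > 0"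
    using linear_bounded_pos[OF linA'] by blast
  \<comment> \<open>The chain \<open>h\<close> below pairs \<open>c j\<close> with index
    \<open>Suc j\<close>, so its geometric bound needs \<open>L ^ j \<le> L ^ Suc j\<close>.\<close>
  define L where "L = max 1 L0"
  have L1: "L \<ge> 1" by (simp add: L_def)
  have L: "norm (adjoint A v) \<le> L * norm v" for v
    by (rule order_trans[OF L0(1)]) (simp add: L_def mult_right_mono)
  have c_Suc: "c (Suc k) = adjoint A (c k)" for k
    by (simp add: c_def)
  have cb: "norm (c k) \<le> norm b * L ^ k" for k
  proof (induction k)
    case 0
    show ?case by (simp add: c_def)
  next
    case (Suc k)
    have "norm (c (Suc k)) \<le> L * norm (c k)"
      unfolding c_Suc by (rule L)
    also have "\<dots> \<le> L * (norm b * L ^ k)"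
      using Suc L1 by (simp add: mult_left_mono)
    finally show ?case by (simp add: mult_ac)
  qed
  \<comment> \<open>Integrating the Taylor series of \<open>b \<bullet> y\<close> termwise over
    \<open>{0..t}\<close> turns \<open>fact k\<close> into \<open>fact (Suc k)\<close>; one factor
    \<open>t\<close> is split off.\<close>
  define H where "H = (\<lambda>t. \<Sum>k. (t ^ k / fact (Suc k)) *\<^sub>R c k)"
  have Hterm: "norm ((t ^ k / fact (Suc k)) *\<^sub>R c k) \<le> norm b * (inverse (fact k) * L ^ k)"
    if "t \<in> {0..1}" for t :: real and k
  proof -
    have "\<bar>t ^ k / fact (Suc k)\<bar> \<le> inverse (fact k)"
    proof -
      have "\<bar>t ^ k / fact (Suc k)\<bar> \<le> 1 / fact (Suc k)"
        using that by (simp add: power_le_one divide_right_mono del: fact_Suc)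
      also have "\<dots> \<le> 1 / fact k"
        by (intro divide_left_mono fact_mono) auto
      finally show ?thesis by (simp add: inverse_eq_divide)
    qed
    then have "\<bar>t ^ k / fact (Suc k)\<bar> * norm (c k) \<le> inverse (fact k) * (norm b * L ^ k)"
      using cb by (intro mult_mono) auto
    then show ?thesis by (simp add: mult_ac)
  qed
  have sumM: "summable (\<lambda>k. norm b * (inverse (fact k) * L ^ k))"
    by (intro summable_mult summable_exp)
  have sumH: "summable (\<lambda>k. (t ^ k / fact (Suc k)) *\<^sub>R c k)" if "t \<in> {0..1}" for t :: real
    using Hterm[OF that] sumM by (intro summable_comparison_test'[OF sumM])
  have "uniform_limit {0..1} (\<lambda>n t. \<Sum>k<n. (t ^ k / fact (Suc k)) *\<^sub>R c k) H sequentially"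
    unfolding H_def using Hterm sumM by (rule Weierstrass_m_test)
  then have contH: "continuous_on {0..1} H"
    by (rule uniform_limit_theorem[rotated])
      (auto intro!: always_eventually continuous_intros)
  have H0: "H 0 = b"
  proof -
    have "H 0 = (\<Sum>k. if k = 0 then b else 0)"
      unfolding H_def by (intro suminf_cong) (auto simp: c_def)
    also have "\<dots> = b"
      using suminf_finite[of "{0::nat}" "\<lambda>k. if k = 0 then b else 0"] by simp
    finally show ?thesis .
  qed
  have series: "q t - q 0 = t * (H t \<bullet> y 0)"
    if y: "\<forall>t\<in>{0..1}. (y has_vector_derivative A (y t)) (at t within {0..1})"
      and q: "\<forall>t\<in>{0..1}. (q has_real_derivative b \<bullet> y t) (at t within {0..1})"
      and t: "t \<in> {0..1}" for y q t
  proof -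
    \<comment> \<open>The chain of derivatives starts one level below \<open>b \<bullet> y\<close>,
      at its antiderivative \<open>q s - q 0\<close>, which vanishes at 0. The Taylor series at 0
      therefore has no constant term.\<close>
    define h where "h = (\<lambda>k s. case k of 0 \<Rightarrow> q s - q 0 | Suc j \<Rightarrow> c j \<bullet> y s)"
    have hd: "(h k has_real_derivative h (Suc k) s) (at s within {0..1})" if s: "s \<in> {0..1}" for k s
    proof (cases k)
      case 0
      then show ?thesis
        using DERIV_diff[OF q[rule_format, OF s] DERIV_const, of "q 0"]
        by (simp add: h_def c_def)
    next
      case (Suc j)
      have "((\<lambda>s. c j \<bullet> y s) has_vector_derivative c j \<bullet> A (y s)) (at s within {0..1})"
        using bounded_linear.has_vector_derivative[OF bounded_linear_inner_right y[rule_format, OF s]] .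
      moreover have "c j \<bullet> A (y s) = c (Suc j) \<bullet> y s"
        unfolding c_Suc using adjoint_works[OF assms, of "y s" "c j"] by (simp add: inner_commute)
      ultimately show ?thesis
        by (simp add: h_def Suc has_real_derivative_iff_has_vector_derivative)
    qed
    have "continuous_on {0..1} y"
      using y by (meson continuous_on_vector_derivative)
    then have "bounded (y ` {0..1})"
      by (intro compact_imp_bounded compact_continuous_image) auto
    then obtain Y where Y: "\<forall>s\<in>{0..1}. norm (y s) \<le> Y"
      by (auto simp: bounded_iff)
    have Y0: "0 \<le> Y" by (rule order_trans[OF norm_ge_zero bspec[OF Y, of 0]]) simp
    have "continuous_on {0..1} (h 0)"
      using hd by (meson DERIV_continuous_on)
    then have "bounded (h 0 ` {0..1})"
      by (intro compact_imp_bounded compact_continuous_image) auto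
    then obtain P where P: "\<forall>s\<in>{0..1}. \<bar>h 0 s\<bar> \<le> P"
      by (auto simp: bounded_iff)
    \<comment> \<open>\<open>P\<close> covers index 0 of the chain and \<open>norm b * Y\<close> the
      other indices. \<open>M\<close> may depend on \<open>y\<close> and \<open>q\<close>, because
      it serves only convergence and does not enter the final constant.\<close>
    define M where "M = max P (norm b * Y)"
    have M0: "0 \<le> M" using Y0 by (simp add: M_def le_max_iff_disj)
    have hb: "\<bar>h k s\<bar> \<le> M * L ^ k" if s: "s \<in> {0..1}" for k s
    proof (cases k)
      case 0
      then show ?thesis using bspec[OF P s] by (simp add: M_def)
    next
      case (Suc j)
      have "\<bar>h k s\<bar> \<le> norm (c j) * norm (y s)"
        unfolding Suc h_def by (simp add: Cauchy_Schwarz_ineq2)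
      also have "\<dots> \<le> (norm b * L ^ j) * Y"
        using cb[of j] bspec[OF Y s] L1 by (intro mult_mono) auto
      also have "\<dots> = (norm b * Y) * L ^ j" by simp
      also have "\<dots> \<le> M * L ^ k"
        unfolding Suc using L1 M0 Y0 by (intro mult_mono power_increasing) (auto simp: M_def)
      finally show ?thesis .
    qed
    have "(\<lambda>j. t ^ j / fact j * h j 0) sums h 0 t"
      by (rule derivative_chain_sums[OF hd hb t])
    then have "(\<lambda>j. t ^ Suc j / fact (Suc j) * h (Suc j) 0) sums (h 0 t - t ^ 0 / fact 0 * h 0 0)"
      by (subst sums_Suc_iff) (simp add: h_def)
    then have 1: "(\<lambda>j. t ^ Suc j / fact (Suc j) * (c j \<bullet> y 0)) sums (q t - q 0)"
      by (simp add: h_def)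
    have "(\<lambda>j. t * (((t ^ j / fact (Suc j)) *\<^sub>R c j) \<bullet> y 0)) sums (t * (H t \<bullet> y 0))"
      unfolding H_def
      by (intro sums_mult bounded_linear.sums[OF bounded_linear_inner_left] summable_sums sumH t)
    then have 2: "(\<lambda>j. t ^ Suc j / fact (Suc j) * (c j \<bullet> y 0)) sums (t * (H t \<bullet> y 0))"
      by (simp add: mult_ac)
    show ?thesis using 1 2 by (rule sums_unique2)
  qed
  \<comment> \<open>The point 0 is left out because recovering \<open>H t \<bullet> y 0\<close> from
    \<open>q\<close> costs a division by \<open>t\<close>.\<close>
  define G where "G = H ` {0<..1}"
  have "b \<in> closure G"
  proof -
    have "(\<lambda>n. H (inverse (real (Suc n)))) \<longlonglongrightarrow> H 0"
    proof (rule continuous_on_tendsto_compose[OF contH LIMSEQ_inverse_real_of_nat])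
      show "\<forall>\<^sub>F n in sequentially. inverse (real (Suc n)) \<in> {0..1}"
        by (intro always_eventually allI) (auto simp: inverse_le_1_iff)
    qed simp
    moreover have "H (inverse (real (Suc n))) \<in> G" for n
      unfolding G_def by (rule imageI) (auto simp: inverse_le_1_iff)
    ultimately show ?thesis
      unfolding closure_sequential H0
      by (intro exI[of _ "\<lambda>n. H (inverse (real (Suc n)))"] conjI allI)
  qed
  then have "b \<in> span G"
    by (metis closed_span closure_minimal span_superset subsetD)
  \<comment> \<open>Gathering all pairs of initial value and integral bound lets the span induction
    produce one \<open>K\<close> per vector, valid for all solutions at once.\<close>
  define adm where "adm = {(y0, N). \<exists>y q. y0 = y 0 \<and>
    (\<forall>t\<in>{0..1}. (y has_vector_derivative A (y t)) (at t within {0..1})) \<and>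
    (\<forall>t\<in>{0..1}. (q has_real_derivative b \<bullet> y t) (at t within {0..1})) \<and>
    (\<forall>t\<in>{0..1}. \<bar>q t - q 0\<bar> \<le> N)}"
  have "\<exists>K. \<forall>(y0, N)\<in>adm. \<bar>b \<bullet> y0\<bar> \<le> K * N"
    using \<open>b \<in> span G\<close>
  proof (induction rule: span_induct_alt)
    case base
    show ?case by (rule exI[of _ 0]) auto
  next
    case (step r a v)
    then obtain t where t: "0 < t" "t \<le> 1" "a = H t"
      by (auto simp: G_def)
    obtain K where K: "\<And>y0 N. (y0, N) \<in> adm \<Longrightarrow> \<bar>v \<bullet> y0\<bar> \<le> K * N"
      using step by fast
    have H_bound: "\<bar>a \<bullet> y0\<bar> \<le> 1 / t * N" if y0N: "(y0, N) \<in> adm" for y0 N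
    proof -
      obtain y q where yq: "y0 = y 0"
        "\<forall>t\<in>{0..1}. (y has_vector_derivative A (y t)) (at t within {0..1})"
        "\<forall>t\<in>{0..1}. (q has_real_derivative b \<bullet> y t) (at t within {0..1})"
        "\<forall>t\<in>{0..1}. \<bar>q t - q 0\<bar> \<le> N"
        using y0N unfolding adm_def by blast
      have "t * \<bar>a \<bullet> y0\<bar> = \<bar>q t - q 0\<bar>"
        using series[OF yq(2,3)] t yq(1) by (simp add: abs_mult)
      also have "\<dots> \<le> N" using yq(4) t by simp
      finally show ?thesis using t by (simp add: field_simps)
    qed
    have "\<bar>(r *\<^sub>R a + v) \<bullet> y0\<bar> \<le> (\<bar>r\<bar> * (1 / t) + K) * N" if "(y0, N) \<in> adm" for y0 N
    proof -
      have "\<bar>(r *\<^sub>R a + v) \<bullet> y0\<bar> \<le> \<bar>r\<bar> * \<bar>a \<bullet> y0\<bar> + \<bar>v \<bullet> y0\<bar>"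
        unfolding inner_add_left inner_scaleR_left abs_mult[symmetric] by (rule abs_triangle_ineq)
      also have "\<dots> \<le> \<bar>r\<bar> * (1 / t * N) + K * N"
        using K[OF that] H_bound[OF that]
        by (intro add_mono mult_left_mono) auto
      finally show ?thesis by (simp add: algebra_simps)
    qed
    then show ?case by blast
  qed
  then show ?thesis
    unfolding adm_def by blast
qed

section \<open>Time derivatives and smoothness of trajectories\<close>

lemma time_deriv_eqI:
  assumes "(g has_vector_derivative d) (at t within {0..})" "0 \<le> t"
  shows "time_deriv {0..} g t = d"
proof -
  \<comment> \<open>A derivative within \<open>{0..}\<close> is unique at limit points of that set;
    the interval to the right of \<open>t\<close> also covers \<open>t = 0\<close>.\<close>
  have "t islimpt {t..t + 1}" by (simp add: islimpt_Icc)
  then have "t islimpt {0..}" by (rule islimpt_subset) (use assms(2) in auto)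
  then show ?thesis
    unfolding time_deriv_def using assms(1)
    by (intro vector_derivative_within) (simp_all add: trivial_limit_within)
qed

text \<open>A proposed derivative agrees with \<open>time_deriv J g\<close> on \<open>J\<close>
  only, so smoothness must be insensitive to values elsewhere.\<close>

lemma cont_diff_cong:
  assumes "\<And>t. t \<in> J \<Longrightarrow> g t = h t" "cont_diff n J g"
  shows "cont_diff n J h"
  using assms
proof (induction n arbitrary: g h)
  case 0
  then show ?case by (simp cong: continuous_on_cong)
next
  case (Suc n)
  have "h differentiable_on J"
    using Suc.prems unfolding differentiable_on_def differentiable_def cont_diff.simps
    by (metis has_derivative_transform)
  moreover have "time_deriv J g t = time_deriv J h t" if "t \<in> J" for t
  proof -
    have "(g has_vector_derivative d) (at t within J) \<longleftrightarrow> (h has_vector_derivative d) (at t within J)" for d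
      using Suc.prems(1) that by (metis has_vector_derivative_transform)
    then show ?thesis by (simp add: time_deriv_def vector_derivative_def)
  qed
  ultimately show ?case
    using Suc.IH[of "time_deriv J g" "time_deriv J h"] Suc.prems(2) by simp
qed

lemma cont_diff_SucI:
  assumes "\<And>t. 0 \<le> t \<Longrightarrow> (g has_vector_derivative g' t) (at t within {0..})"
    and "cont_diff n {0..} g'"
  shows "cont_diff (Suc n) {0..} g"
proof -
  have "g differentiable_on {0..}"
    using assms(1) unfolding differentiable_on_def
    by (auto intro: differentiableI_vector)
  moreover have "cont_diff n {0..} (time_deriv {0..} g)"
    by (rule cont_diff_cong[OF _ assms(2)]) (simp add: time_deriv_eqI[OF assms(1)])
  ultimately show ?thesis by simp
qed

lemma bounded_bilinear_matrix_vector_mult: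
  "bounded_bilinear (\<lambda>(M :: real^'n^'m) v. M *v v)"
proof -
  have "bilinear (\<lambda>(M :: real^'n^'m) v. M *v v)"
    by (simp add: bilinear_def linear_iff matrix_vector_mult_add_rdistrib matrix_vector_right_distrib
        scaleR_matrix_vector_assoc matrix_vector_mult_scaleR)
  then show ?thesis by (simp add: bilinear_conv_bounded_bilinear)
qed

text \<open>By the chain rule the right-hand side of the state equation has derivative
  \<open>Df x x' + B w'\<close>, which is continuous. This provides the regularity of
  \<open>x\<close> that \<open>behaviour_C\<close> demands.\<close>

lemma solution_cont_diff_2:
  assumes f: "C1_with_jacobian X f Df"
    and xX: "\<And>t. 0 \<le> t \<Longrightarrow> x t \<in> X"
    and x': "\<And>t. 0 \<le> t \<Longrightarrow> (x has_vector_derivative f (x t) + B *v w t) (at t within {0..})"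
    and w': "\<And>t. 0 \<le> t \<Longrightarrow> (w has_vector_derivative w' t) (at t within {0..})"
    and cw': "continuous_on {0..} w'"
  shows "cont_diff 2 {0..} x"
proof -
  note cmv = bounded_bilinear.continuous_on[OF bounded_bilinear_matrix_vector_mult]
  have cx: "continuous_on {0..} x" and cw: "continuous_on {0..} w"
    using x' w' by (auto intro!: continuous_on_vector_derivative)
  have df: "(f has_derivative (\<lambda>h. Df \<xi> *v h)) (at \<xi> within X)" if "\<xi> \<in> X" for \<xi>
    using f that by (simp add: C1_with_jacobian_def)
  have cDf: "continuous_on X Df"
    using f by (simp add: C1_with_jacobian_def)
  have cf: "continuous_on X f"
    using df by (rule has_derivative_continuous_on)
  have sub: "x ` {0..} \<subseteq> X" using xX by auto
  have cfx: "continuous_on {0..} (\<lambda>t. f (x t))"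
    by (rule continuous_on_compose2[OF cf cx sub])
  have cDfx: "continuous_on {0..} (\<lambda>t. Df (x t))"
    by (rule continuous_on_compose2[OF cDf cx sub])
  have "((\<lambda>t. f (x t) + B *v w t) has_vector_derivative
      Df (x t) *v (f (x t) + B *v w t) + B *v w' t) (at t within {0..})" if t: "0 \<le> t" for t
  proof (rule has_vector_derivative_add)
    \<comment> \<open>\<open>f\<close> is differentiable only within \<open>X\<close>, so the chain
      rule is applied relative to the range of \<open>x\<close>.\<close>
    have "(f has_derivative (\<lambda>h. Df (x t) *v h)) (at (x t) within x ` {0..})"
      using df[OF xX[OF t]] sub by (rule has_derivative_subset)
    from vector_derivative_diff_chain_within[OF x'[OF t] this]
    show "((\<lambda>t. f (x t)) has_vector_derivative Df (x t) *v (f (x t) + B *v w t)) (at t within {0..})"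
      by (simp add: o_def)
    show "((\<lambda>t. B *v w t) has_vector_derivative B *v w' t) (at t within {0..})"
      by (rule bounded_linear.has_vector_derivative[OF matrix_vector_mul_bounded_linear w'[OF t]])
  qed
  then have "cont_diff 1 {0..} (\<lambda>t. f (x t) + B *v w t)"
    unfolding One_nat_def
    by (rule cont_diff_SucI)
      (auto intro!: cmv continuous_on_add cfx cDfx cw cw' continuous_on_const)
  from cont_diff_SucI[OF x' this] show ?thesis
    by (simp only: numeral_2_eq_2 One_nat_def)
qed

section \<open>The averaged Jacobian\<close>

text \<open>This is the fundamental theorem of calculus along the segment from \<open>xs\<close> to
  \<open>x\<close>, which convexity keeps inside \<open>X\<close>. The constant vector
  \<open>x - xs\<close> comes out of the integral by linearity.\<close>

lemma diff_eq_Abar: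
  assumes f: "C1_with_jacobian X f Df" and X: "convex X" "x \<in> X" "xs \<in> X"
  shows "f x - f xs = Abar Df x xs *v (x - xs)"
proof -
  define p where "p = (\<lambda>l::real. xs + l *\<^sub>R (x - xs))"
  have pX: "p l \<in> X" if "l \<in> {0..1}" for l
    using convexD_alt[OF X(1,3,2), of l] that by (simp add: p_def algebra_simps)
  have cDf: "continuous_on {0..1} (\<lambda>l. Df (p l))"
  proof (rule continuous_on_compose2[of X Df "{0..1}" p])
    show "continuous_on X Df" using f by (simp add: C1_with_jacobian_def)
    show "continuous_on {0..1} p" unfolding p_def by (intro continuous_intros)
  qed (use pX in auto)
  have "((\<lambda>l. f (p l)) has_vector_derivative Df (p l) *v (x - xs)) (at l within {0..1})"
    if l: "l \<in> {0..1}" for l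
  proof -
    have p': "(p has_vector_derivative (x - xs)) (at l within {0..1})"
      unfolding p_def by (auto intro!: derivative_eq_intros)
    have "(f has_derivative (\<lambda>h. Df (p l) *v h)) (at (p l) within X)"
      using f pX[OF l] by (simp add: C1_with_jacobian_def)
    then have "(f has_derivative (\<lambda>h. Df (p l) *v h)) (at (p l) within p ` {0..1})"
      by (rule has_derivative_subset) (use pX in auto)
    from vector_derivative_diff_chain_within[OF p' this] show ?thesis by (simp add: o_def)
  qed
  then have "((\<lambda>l. Df (p l) *v (x - xs)) has_integral (f (p 1) - f (p 0))) {0..1}"
    by (intro fundamental_theorem_of_calculus) auto
  moreover have "((\<lambda>l. Df (p l) *v (x - xs)) has_integral (integral {0..1} (\<lambda>l. Df (p l)) *v (x - xs))) {0..1}"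
    using has_integral_linear[OF integrable_integral[OF integrable_continuous_real[OF cDf]]
        bounded_bilinear.bounded_linear_left[OF bounded_bilinear_matrix_vector_mult, of "x - xs"]]
    by (simp add: o_def)
  ultimately have "f (p 1) - f (p 0) = integral {0..1} (\<lambda>l. Df (p l)) *v (x - xs)"
    by (rule has_integral_unique)
  then show ?thesis by (simp add: p_def Abar_def)
qed

lemma matrix_vector_mult_uminus_left: "(- A) *v v = - (A *v (v :: real^'n))"
  by (simp add: matrix_vector_mult_def vec_eq_iff sum_negf)

section \<open>A uniform bound on the initial velocity\<close>

text \<open>\<open>K\<close> is chosen before the equilibrium and the trajectory, so it can enter
  the offset of the gain bound. Compactness controls \<open>x\<close> and \<open>f x\<close>; the
  contribution of the input is recovered by applying \<open>linear_ode_initial_bound\<close> to each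
  row of \<open>B\<close>.\<close>

lemma initial_velocity_bounded:
  fixes X :: "(real^'nx) set" and W :: "(real^'nw) set" and Z :: "(real^'nz) set"
  assumes X: "compact X" and f: "continuous_on X f"
  shows "\<exists>K. \<forall>xs ws zs x w z. (xs, ws, zs) \<in> equilibria X W Z f B C \<longrightarrow>
    (x, w, z) \<in> behaviour X W Z f B C \<longrightarrow> w \<in> exo_inputs W Aw ws \<longrightarrow>
    norm (f (x 0) + B *v w 0) \<le> K"
proof -
  obtain D where D: "\<forall>\<xi>\<in>X. norm \<xi> \<le> D"
    using compact_imp_bounded[OF X] by (auto simp: bounded_iff)
  obtain M where M: "\<forall>\<xi>\<in>X. norm (f \<xi>) \<le> M"
    using compact_imp_bounded[OF compact_continuous_image[OF f X]] by (auto simp: bounded_iff)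
  \<comment> \<open>\<open>2 * D\<close> bounds the displacement of \<open>x\<close>, and
    \<open>2 * M\<close> bounds the integral of \<open>f x - f xs\<close> over at most unit
    time.\<close>
  define N where "N = 2 * D + 2 * M"
  define bd where "bd = (\<lambda>i K. \<forall>y q N.
    (\<forall>t\<in>{0..1}. (y has_vector_derivative Aw *v y t) (at t within {0..1})) \<longrightarrow>
    (\<forall>t\<in>{0..1}. (q has_real_derivative B $ i \<bullet> y t) (at t within {0..1})) \<longrightarrow>
    (\<forall>t\<in>{0..1}. \<bar>q t - q 0\<bar> \<le> N) \<longrightarrow> \<bar>B $ i \<bullet> y 0\<bar> \<le> K * N)"
  have "\<forall>i. \<exists>K. bd i K"
    unfolding bd_def by (intro allI linear_ode_initial_bound matrix_vector_mul_linear)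
  then obtain K where K: "\<And>i. bd i (K i)"
    by metis
  have "norm (f (x 0) + B *v w 0) \<le> 2 * M + (\<Sum>i\<in>UNIV. K i * N)"
    if E: "(xs, ws, zs) \<in> equilibria X W Z f B C" and sol: "(x, w, z) \<in> behaviour X W Z f B C"
      and exo: "w \<in> exo_inputs W Aw ws" for xs ws zs x w z
  proof -
    have xs: "xs \<in> X" "f xs = - (B *v ws)"
      using E by (auto simp: equilibria_def eq_neg_iff_add_eq_0)
    have xX: "x t \<in> X" and x': "(x has_vector_derivative f (x t) + B *v w t) (at t within {0..1})"
      if "t \<in> {0..1}" for t
      using sol that
      by (auto simp: behaviour_def solution_on_def intro: has_vector_derivative_within_subset)
    define y where "y = (\<lambda>t. w t - ws)"
    have w': "(w has_vector_derivative Aw *v y t) (at t within {0..1})" if "t \<in> {0..1}" for t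
      using exo that unfolding y_def
      by (auto simp: exo_inputs_def intro: has_vector_derivative_within_subset)
    have y': "\<forall>t\<in>{0..1}. (y has_vector_derivative Aw *v y t) (at t within {0..1})"
    proof
      fix t :: real assume "t \<in> {0..1}"
      from has_vector_derivative_diff[OF w'[OF this] has_vector_derivative_const]
      show "(y has_vector_derivative Aw *v y t) (at t within {0..1})"
        by (simp add: y_def)
    qed
    then have cy: "continuous_on {0..1} y"
      by (meson continuous_on_vector_derivative)
    define P where "P = (\<lambda>t. integral {0..t} y)"
    have P': "(P has_vector_derivative y t) (at t within {0..1})" if "t \<in> {0..1}" for t
      unfolding P_def using cy that by (rule integral_has_vector_derivative)
    have P0: "P 0 = 0" by (simp add: P_def)
    \<comment> \<open>Subtracting \<open>B *v P t\<close> removes the input from the state equation: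
      since \<open>f xs = - (B *v ws)\<close>, the derivative left is
      \<open>f (x t) - f xs\<close>.\<close>
    define g where "g = (\<lambda>t. x t - B *v P t)"
    have g': "(g has_vector_derivative f (x t) - f xs) (at t within {0..1})" if "t \<in> {0..1}" for t
    proof -
      have "(g has_vector_derivative (f (x t) + B *v w t) - B *v y t) (at t within {0..1})"
        unfolding g_def
        by (intro has_vector_derivative_diff x' that
            bounded_linear.has_vector_derivative[OF matrix_vector_mul_bounded_linear P'])
      then show ?thesis
        by (simp add: y_def xs matrix_vector_mult_diff_distrib)
    qed
    have f_diff: "norm (f (x t) - f xs) \<le> 2 * M" if "t \<in> {0..1}" for t
      using norm_triangle_ineq4[of "f (x t)" "f xs"] bspec[OF M xX[OF that]] bspec[OF M xs(1)]
      by linarith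
    have BP: "norm (B *v P t) \<le> N" if t: "t \<in> {0..1}" for t
    proof -
      have M0: "0 \<le> 2 * M" by (rule order_trans[OF norm_ge_zero f_diff[OF t]])
      have "norm (g t - g 0) \<le> 2 * M * norm (t - 0)"
      proof (rule differentiable_bound)
        fix s :: real assume s: "s \<in> {0..1}"
        show "(g has_derivative (\<lambda>h. h *\<^sub>R (f (x s) - f xs))) (at s within {0..1})"
          using g'[OF s] by (simp add: has_vector_derivative_def)
        show "onorm (\<lambda>h. h *\<^sub>R (f (x s) - f xs)) \<le> 2 * M"
          using f_diff[OF s] by (intro onorm_le) (simp add: mult.commute mult_left_mono)
      qed (use t in auto)
      also have "\<dots> \<le> 2 * M" using t M0 by (simp add: mult_left_le)
      finally have "norm (g t - g 0) \<le> 2 * M" .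
      moreover have "B *v P t = (x t - x 0) - (g t - g 0)"
        by (simp add: g_def P0)
      ultimately have "norm (B *v P t) \<le> norm (x t - x 0) + 2 * M"
        using norm_triangle_ineq4[of "x t - x 0" "g t - g 0"] by simp
      also have "norm (x t - x 0) \<le> 2 * D"
        using norm_triangle_ineq4[of "x t" "x 0"] bspec[OF D xX[OF t]] bspec[OF D xX[of 0]] by auto
      finally show ?thesis by (simp add: N_def)
    qed
    \<comment> \<open>The antiderivative required for row \<open>i\<close> is the
      \<open>i\<close>-th component of \<open>B *v P t\<close>, which \<open>N\<close>
      bounds.\<close>
    have "\<bar>B $ i \<bullet> y 0\<bar> \<le> K i * N" for i
    proof (rule K[unfolded bd_def, rule_format, OF y'[rule_format]])
      fix t :: real assume t: "t \<in> {0..1}"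
      show "((\<lambda>t. B $ i \<bullet> P t) has_real_derivative B $ i \<bullet> y t) (at t within {0..1})"
        unfolding has_real_derivative_iff_has_vector_derivative
        by (intro bounded_linear.has_vector_derivative[OF bounded_linear_inner_right] P' t)
      show "\<bar>B $ i \<bullet> P t - B $ i \<bullet> P 0\<bar> \<le> N"
        using BP[OF t] component_le_norm_cart[of "B *v P t" i]
        by (simp add: P0 matrix_vector_mul_component)
    qed
    then have By: "norm (B *v y 0) \<le> (\<Sum>i\<in>UNIV. K i * N)"
      by (intro order_trans[OF norm_le_l1_cart] sum_mono) (simp add: matrix_vector_mul_component)
    have *: "f (x 0) + B *v w 0 = (f (x 0) - f xs) + B *v y 0"
      by (simp add: y_def xs matrix_vector_mult_diff_distrib)
    show ?thesis
      unfolding * using By norm_triangle_ineq[of "f (x 0) - f xs" "B *v y 0"] f_diff[of 0, simplified]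
      by linarith
  qed
  then show ?thesis by blast
qed

section \<open>The gain bound\<close>

theorem corollary1:
  fixes X :: "(real^'nx) set" and W :: "(real^'nw) set" and Z :: "(real^'nz) set"
    and f :: "real^'nx \<Rightarrow> real^'nx" and Df :: "real^'nx \<Rightarrow> real^'nx^'nx"
    and B :: "real^'nw^'nx" and C :: "real^'nx^'nz" and Aw :: "real^'nw^'nw"
    and \<alpha> \<beta> \<gamma> :: real
  assumes "convex X" and "compact X"
    and "C1_with_jacobian X f Df"
    and "forward_complete X W Z f B C" and "unique_solutions X W Z f B C"
    and "equilibrium_bijection (equilibria X W Z f B C)"
    and "C ** B = 0"
    and "hurwitz Aw" and "onorm (\<lambda>v. Aw *v v) \<le> \<beta>"
    and "velocity_dissipative X W Z f B C (\<gamma>\<^sup>2 *\<^sub>R mat 1) 0 (- mat 1)"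
    and "\<alpha> > 0"
    and "\<forall>xs \<in> eq_states (equilibria X W Z f B C). \<forall>x\<in>X.
           (x - xs) \<bullet> ((transpose (Abar Df x xs) ** transpose C ** (- mat 1) ** C ** Abar Df x xs) *v (x - xs))
           \<le> inverse \<alpha> * ((x - xs) \<bullet> ((transpose C ** (- mat 1) ** C) *v (x - xs)))"
  shows "Ls2_gain_bound X W Z f B C Aw (sqrt (\<alpha> * \<beta>\<^sup>2 * \<gamma>\<^sup>2))"
proof -
  note cmv = bounded_linear.continuous_on[OF matrix_vector_mul_bounded_linear]
  let ?E = "equilibria X W Z f B C"
  have cf: "continuous_on X f"
    by (rule has_derivative_continuous_on[where f' = "\<lambda>\<xi>. (*v) (Df \<xi>)"])
      (use assms(3) in \<open>simp add: C1_with_jacobian_def\<close>)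
  obtain K where K: "\<And>xs ws zs x w z. \<lbrakk>(xs, ws, zs) \<in> ?E; (x, w, z) \<in> behaviour X W Z f B C;
      w \<in> exo_inputs W Aw ws\<rbrakk> \<Longrightarrow> norm (f (x 0) + B *v w 0) \<le> K"
    using initial_velocity_bounded[OF assms(2) cf, of W Z B C Aw] by blast
  obtain V where V0: "\<forall>\<xi>. 0 \<le> V \<xi>" and V: "pos_def_decrescent V"
    and V_diss: "\<forall>t0 t1. 0 \<le> t0 \<and> t0 \<le> t1 \<longrightarrow>
      (\<forall>(dx, dw, dz) \<in> behaviour_VF X W Z f B C. V (dx t1) - V (dx t0)
        \<le> integral {t0..t1} (\<lambda>t. supply_rate (\<gamma>\<^sup>2 *\<^sub>R mat 1) 0 (- mat 1) (dw t) (dz t)))"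
    using assms(10) unfolding velocity_dissipative_def by (elim conjE exE) (rule that; assumption)
  have diss: "V (dx t1) - V (dx t0)
        \<le> integral {t0..t1} (\<lambda>t. supply_rate (\<gamma>\<^sup>2 *\<^sub>R mat 1) 0 (- mat 1) (dw t) (dz t))"
    if "0 \<le> t0" "t0 \<le> t1" "(dx, dw, dz) \<in> behaviour_VF X W Z f B C" for t0 t1 dx dw dz
    using V_diss[rule_format, OF conjI[OF that(1,2)] that(3)] by simp
  obtain b where b: "comparison_fun b" "\<And>\<xi>. V \<xi> \<le> b (norm \<xi>)"
    using V unfolding pos_def_decrescent_def by blast
  \<comment> \<open>Monotonicity of \<open>b\<close> turns the velocity bound \<open>K\<close> into
    the bound \<open>b K\<close> on the initial storage. The factor \<alpha> appears when the
    dissipation inequality is solved for the output energy, the root when passing to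
    seminorms.\<close>
  define \<zeta> where "\<zeta> = sqrt (\<alpha> * b K)"
  have "L2_seminorm T (\<lambda>t. z t - zs) \<le> sqrt (\<alpha> * \<beta>\<^sup>2 * \<gamma>\<^sup>2) * L2_seminorm T (\<lambda>t. w t - ws) + \<zeta>"
    if E: "(xs, ws, zs) \<in> ?E" and T: "0 \<le> T" and sol: "(x, w, z) \<in> behaviour X W Z f B C"
      and exo: "w \<in> exo_inputs W Aw ws" for xs ws zs T x w z
  proof -
    have Vb: "V (f (x 0) + B *v w 0) \<le> b K"
    proof -
      have n: "norm (f (x 0) + B *v w 0) \<le> K" by (rule K[OF E sol exo])
      then have "0 \<le> K" by (rule order_trans[OF norm_ge_zero])
      have "strict_mono_on {0..} b" using b(1) by (simp add: comparison_fun_def)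
      then have "b (norm (f (x 0) + B *v w 0)) \<le> b K"
        by (rule strict_mono_on_leD) (use n \<open>0 \<le> K\<close> in auto)
      with b(2) show ?thesis by (rule order_trans)
    qed
    have xs: "xs \<in> X" "f xs = - (B *v ws)" "zs = C *v xs"
      using E by (auto simp: equilibria_def eq_neg_iff_add_eq_0)
    have xs_eq: "xs \<in> eq_states ?E"
      using E by (force simp: eq_states_def)
    have xX: "x t \<in> X" and z: "z t = C *v x t"
      and x': "(x has_vector_derivative f (x t) + B *v w t) (at t within {0..})" if "0 \<le> t" for t
      using sol that by (auto simp: behaviour_def solution_on_def)
    have w': "(w has_vector_derivative Aw *v (w t - ws)) (at t within {0..})" if "0 \<le> t" for t
      using exo that by (auto simp: exo_inputs_def)
    have cx: "continuous_on {0..} x" and cw: "continuous_on {0..} w"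
      using x' w' by (auto intro!: continuous_on_vector_derivative)
    have cfx: "continuous_on {0..} (\<lambda>t. f (x t))"
      by (rule continuous_on_compose2[OF cf cx]) (use xX in auto)
    have cw': "continuous_on {0..} (\<lambda>t. Aw *v (w t - ws))"
      by (intro cmv continuous_on_diff continuous_on_const cw)
    have cz': "continuous_on {0..} (\<lambda>t. C *v f (x t))"
      by (intro cmv cfx)
    \<comment> \<open>This is used twice: it removes \<open>w\<close> from the output derivative,
      and it removes \<open>f xs = - (B *v ws)\<close> from
      \<open>C *v (f (x t) - f xs)\<close>.\<close>
    have CB: "C *v (B *v v) = 0" for v
      by (simp add: matrix_vector_mul_assoc assms(7))
    have z': "(z has_vector_derivative C *v f (x t)) (at t within {0..})" if t: "0 \<le> t" for t
    proof -
      have "((\<lambda>t. C *v x t) has_vector_derivative C *v (f (x t) + B *v w t)) (at t within {0..})"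
        by (rule bounded_linear.has_vector_derivative[OF matrix_vector_mul_bounded_linear x'[OF t]])
      then have "((\<lambda>t. C *v x t) has_vector_derivative C *v f (x t)) (at t within {0..})"
        by (simp add: matrix_vector_right_distrib CB)
      then show ?thesis
        by (rule has_vector_derivative_transform[rotated 2]) (use t z in auto)
    qed
    have sub: "{0..T} \<subseteq> {0..}" by auto
    have cz: "continuous_on {0..} z"
      using z' by (auto intro!: continuous_on_vector_derivative)
    note cont = cw'[THEN continuous_on_subset, OF sub] cz'[THEN continuous_on_subset, OF sub]
      cw[THEN continuous_on_subset, OF sub] cz[THEN continuous_on_subset, OF sub]
    have int_w: "(\<lambda>t. (norm (w t - ws))\<^sup>2) integrable_on {0..T}"
      and int_z: "(\<lambda>t. (norm (z t - zs))\<^sup>2) integrable_on {0..T}"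
      by (intro integrable_continuous_real continuous_intros cont)+
    \<comment> \<open>Dissipativity speaks only of derivatives of smooth trajectories. The exosystem
      makes \<open>w\<close> continuously differentiable, and this carries over to the
      state.\<close>
    have "(x, w, z) \<in> behaviour_C X W Z f B C"
      unfolding behaviour_C_def
      using sol solution_cont_diff_2[OF assms(3) xX x' w' cw']
        cont_diff_SucI[OF w', of 0] cont_diff_SucI[OF z', of 0] cw' cz'
      by (simp del: cont_diff.simps(2) add: One_nat_def)
    then have "(time_deriv {0..} x, time_deriv {0..} w, time_deriv {0..} z) \<in> behaviour_VF X W Z f B C"
      unfolding behaviour_VF_def by force
    from diss[OF order_refl T this]
    have "- V (time_deriv {0..} x 0) \<le> integral {0..T} (\<lambda>t.
        supply_rate (\<gamma>\<^sup>2 *\<^sub>R mat 1) 0 (- mat 1) (time_deriv {0..} w t) (time_deriv {0..} z t))"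
      using V0[rule_format, of "time_deriv {0..} x T"] by linarith
    also have "time_deriv {0..} x 0 = f (x 0) + B *v w 0"
      by (rule time_deriv_eqI[OF x']) simp_all
    also have "integral {0..T} (\<lambda>t.
        supply_rate (\<gamma>\<^sup>2 *\<^sub>R mat 1) 0 (- mat 1) (time_deriv {0..} w t) (time_deriv {0..} z t))
      = integral {0..T} (\<lambda>t. \<gamma>\<^sup>2 * (norm (Aw *v (w t - ws)))\<^sup>2 - (norm (C *v f (x t)))\<^sup>2)"
      by (rule integral_cong)
        (simp add: time_deriv_eqI[OF w'] time_deriv_eqI[OF z'] supply_rate_def power2_norm_eq_inner
          scaleR_matrix_vector_assoc[symmetric] matrix_vector_mult_uminus_left)
    also have "\<dots> \<le> integral {0..T} (\<lambda>t. \<gamma>\<^sup>2 * \<beta>\<^sup>2 * (norm (w t - ws))\<^sup>2 - inverse \<alpha> * (norm (z t - zs))\<^sup>2)"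
    proof (rule integral_le)
      show "(\<lambda>t. \<gamma>\<^sup>2 * (norm (Aw *v (w t - ws)))\<^sup>2 - (norm (C *v f (x t)))\<^sup>2) integrable_on {0..T}"
        by (intro integrable_continuous_real continuous_intros cont)
      show "(\<lambda>t. \<gamma>\<^sup>2 * \<beta>\<^sup>2 * (norm (w t - ws))\<^sup>2 - inverse \<alpha> * (norm (z t - zs))\<^sup>2) integrable_on {0..T}"
        by (intro integrable_continuous_real continuous_intros cont)
      fix t assume "t \<in> {0..T}"
      then have t: "0 \<le> t" by simp
      let ?d = "x t - xs" and ?A = "Abar Df (x t) xs"
      have "norm (Aw *v (w t - ws)) \<le> \<beta> * norm (w t - ws)"
        using onorm[OF matrix_vector_mul_bounded_linear, of Aw "w t - ws"] assms(9)
        by (meson mult_right_mono norm_ge_zero order_trans)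
      then have "(norm (Aw *v (w t - ws)))\<^sup>2 \<le> (\<beta> * norm (w t - ws))\<^sup>2"
        by (intro power_mono) auto
      then have 1: "\<gamma>\<^sup>2 * (norm (Aw *v (w t - ws)))\<^sup>2 \<le> \<gamma>\<^sup>2 * \<beta>\<^sup>2 * (norm (w t - ws))\<^sup>2"
        by (simp add: power_mult_distrib mult.assoc mult_left_mono)
      have "f (x t) - f xs = ?A *v ?d"
        by (rule diff_eq_Abar[OF assms(3,1) xX[OF t] xs(1)])
      then have "C *v (f (x t) - f xs) = C *v (?A *v ?d)" by simp
      then have Cf: "C *v f (x t) = C *v (?A *v ?d)"
        by (simp add: xs(2) matrix_vector_right_distrib CB)
      \<comment> \<open>With the middle factor \<open>- mat 1\<close>, both sides of the assumed
        matrix inequality are negated squared norms. It therefore reads in reverse, as a lower bound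
        on the output velocity by the output deviation.\<close>
      have quad: "v \<bullet> ((transpose M ** (- mat 1) ** M) *v v) = - (norm (M *v v))\<^sup>2"
        for M :: "real^'nx^'nz" and v
      proof -
        have "(transpose M ** (- mat 1) ** M) *v v = transpose M *v (- (M *v v))"
          by (simp add: matrix_vector_mul_assoc[symmetric] matrix_vector_mult_uminus_left)
        then show ?thesis
          using dot_lmul_matrix[of v "transpose M" "- (M *v v)"]
          by (simp add: power2_norm_eq_inner)
      qed
      have "?d \<bullet> ((transpose ?A ** transpose C ** (- mat 1) ** C ** ?A) *v ?d)
          = - (norm (C *v (?A *v ?d)))\<^sup>2"
        using quad[of ?d "C ** ?A"]
        by (simp add: matrix_transpose_mul matrix_mul_assoc matrix_vector_mul_assoc)
      moreover have "?d \<bullet> ((transpose C ** (- mat 1) ** C) *v ?d) = - (norm (z t - zs))\<^sup>2"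
        unfolding quad by (simp add: z[OF t] xs(3) matrix_vector_mult_diff_distrib)
      ultimately have "inverse \<alpha> * (norm (z t - zs))\<^sup>2 \<le> (norm (C *v f (x t)))\<^sup>2"
        using assms(12)[rule_format, OF xs_eq xX[OF t]] by (simp add: Cf)
      with 1 show "\<gamma>\<^sup>2 * (norm (Aw *v (w t - ws)))\<^sup>2 - (norm (C *v f (x t)))\<^sup>2
          \<le> \<gamma>\<^sup>2 * \<beta>\<^sup>2 * (norm (w t - ws))\<^sup>2 - inverse \<alpha> * (norm (z t - zs))\<^sup>2"
        by linarith
    qed
    also have "\<dots> = \<gamma>\<^sup>2 * \<beta>\<^sup>2 * integral {0..T} (\<lambda>t. (norm (w t - ws))\<^sup>2)
        - inverse \<alpha> * integral {0..T} (\<lambda>t. (norm (z t - zs))\<^sup>2)"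
      by (intro integral_unique has_integral_diff has_integral_mult_right integrable_integral int_w int_z)
    finally have "integral {0..T} (\<lambda>t. (norm (z t - zs))\<^sup>2)
        \<le> \<alpha> * \<beta>\<^sup>2 * \<gamma>\<^sup>2 * integral {0..T} (\<lambda>t. (norm (w t - ws))\<^sup>2) + \<alpha> * V (f (x 0) + B *v w 0)"
      using \<open>\<alpha> > 0\<close> by (simp add: field_simps)
    also have "\<dots> \<le> \<alpha> * \<beta>\<^sup>2 * \<gamma>\<^sup>2 * integral {0..T} (\<lambda>t. (norm (w t - ws))\<^sup>2) + \<alpha> * b K"
      using Vb \<open>\<alpha> > 0\<close> by simp
    finally have "L2_seminorm T (\<lambda>t. z t - zs)
        \<le> sqrt (\<alpha> * \<beta>\<^sup>2 * \<gamma>\<^sup>2 * integral {0..T} (\<lambda>t. (norm (w t - ws))\<^sup>2) + \<alpha> * b K)"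
      using \<open>\<alpha> > 0\<close> by (simp add: L2_seminorm_def)
    \<comment> \<open>Subadditivity of the square root separates the gain term from the
      offset.\<close>
    also have "\<dots> \<le> sqrt (\<alpha> * \<beta>\<^sup>2 * \<gamma>\<^sup>2 * integral {0..T} (\<lambda>t. (norm (w t - ws))\<^sup>2)) + sqrt (\<alpha> * b K)"
    proof (rule sqrt_add_le_add_sqrt)
      show "0 \<le> \<alpha> * \<beta>\<^sup>2 * \<gamma>\<^sup>2 * integral {0..T} (\<lambda>t. (norm (w t - ws))\<^sup>2)"
        using \<open>\<alpha> > 0\<close> by (intro mult_nonneg_nonneg integral_nonneg int_w) auto
      show "0 \<le> \<alpha> * b K"
        using \<open>\<alpha> > 0\<close> order_trans[OF V0[rule_format] Vb] by simp
    qed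
    finally show ?thesis
      by (simp add: L2_seminorm_def real_sqrt_mult \<zeta>_def)
  qed
  then show ?thesis
    unfolding Ls2_gain_bound_def by (intro exI[of _ "\<lambda>_ _. \<zeta>"]) auto
qed

end
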